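(* Let $p\in\mathbb{Z}_{\ge1}$ and let $S$ be a non-empty $p$-symmetric set of positive integers. In Ending Partizan Subtraction Nim with removable set $S$ and any terminal rule $W$, $p$ is a period of the outcome sequence: there exists $A\in\mathbb{Z}_{\ge0}$ such that $\mathcal{O}_S(m+p)=\mathcal{O}_S(m)$ for all $m\ge A$.
   Context: A non-empty set $S\subseteq\mathbb{Z}_{\ge1}$ is $p$-symmetric if $p-s\in S$ for all $s\in S$. Ending Partizan Subtraction Nim with removable set $S$ and terminal rule $W$: a position is a number $n\in\mathbb{Z}_{\ge0}$ of tokens; players Left and Right alternate, a move from $n$ removes $s\in S$ tokens with $s\le n$. Positions with no move (i.e. $n<\min S$) are terminal, and $W$ assigns to each terminal position a value in $\{\mathcal{L},\mathcal{R},\mathcal{N},\mathcal{P}\}$: if the game ends at terminal $n$, then Left wins if $W(n)=\mathcal{L}$, Right wins if $W(n)=\mathcal{R}$, the player to move loses if $W(n)=\mathcal{P}$, and the player to move wins if $W(n)=\mathcal{N}$. The outcome $\mathcal{O}_S(n)$ is $\mathcal{L}$ (resp. $\mathcal{R}$) if Left (resp. Right) has a winning strategy from $n$ both moving first and moving second, $\mathcal{N}$ if the first player (whichever) has a winning strategy, and $\mathcal{P}$ if the second player (whichever) has one. *)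

theory Defs
  imports Main
begin

definition p_symmetric :: "nat \<Rightarrow> nat set \<Rightarrow> bool" where
  "p_symmetric p S \<longleftrightarrow> S \<noteq> {} \<and> (\<forall>s\<in>S. 1 \<le> s) \<and> (\<forall>s\<in>S. s \<le> p \<and> p - s \<in> S)"

datatype player = Left | Right

fun opponent :: "player \<Rightarrow> player" where
  "opponent Left = Right"
| "opponent Right = Left"

datatype outcome = \<L> | \<R> | \<N> | \<P>

definition moves :: "nat set \<Rightarrow> nat \<Rightarrow> nat set" where
  "moves S n = {s \<in> S. s \<le> n}"

definition terminal :: "nat set \<Rightarrow> nat \<Rightarrow> bool" where
  "terminal S n \<longleftrightarrow> moves S n = {}"

fun winner :: "outcome \<Rightarrow> player \<Rightarrow> player" where
  "winner \<L> Z = Left"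
| "winner \<R> Z = Right"
| "winner \<N> Z = Z"
| "winner \<P> Z = opponent Z"

text \<open>The player to move after \<open>i\<close> moves, when \<open>Y\<close> moves first.\<close>

definition mover :: "player \<Rightarrow> nat \<Rightarrow> player" where
  "mover Y i = (if even i then Y else opponent Y)"

text \<open>A complete play is recorded as the list of its positions, including the starting one.
  Since \<open>0\<close> is not removable, every play is finite.\<close>

definition complete_play :: "nat set \<Rightarrow> nat \<Rightarrow> nat list \<Rightarrow> bool" where
  "complete_play S n xs \<longleftrightarrow> xs \<noteq> [] \<and> hd xs = n \<and>
     (\<forall>i. Suc i < length xs \<longrightarrow> (\<exists>s\<in>moves S (xs ! i). xs ! Suc i = xs ! i - s)) \<and>
     terminal S (last xs)"

text \<open>A strategy maps the history of positions, ending in the current one, to the number of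
  tokens to remove. It has to prescribe a legal move whenever there is one.\<close>

definition strategy :: "nat set \<Rightarrow> (nat list \<Rightarrow> nat) \<Rightarrow> bool" where
  "strategy S \<sigma> \<longleftrightarrow> (\<forall>h. h \<noteq> [] \<and> \<not> terminal S (last h) \<longrightarrow> \<sigma> h \<in> moves S (last h))"

definition follows :: "player \<Rightarrow> player \<Rightarrow> (nat list \<Rightarrow> nat) \<Rightarrow> nat list \<Rightarrow> bool" where
  "follows X Y \<sigma> xs \<longleftrightarrow>
     (\<forall>i. Suc i < length xs \<and> mover Y i = X \<longrightarrow> xs ! Suc i = xs ! i - \<sigma> (take (Suc i) xs))"

text \<open>\<open>X\<close> has a winning strategy from \<open>n\<close> when \<open>Y\<close> moves first.\<close>

definition has_winning_strategy ::
    "nat set \<Rightarrow> (nat \<Rightarrow> outcome) \<Rightarrow> player \<Rightarrow> player \<Rightarrow> nat \<Rightarrow> bool" where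
  "has_winning_strategy S W X Y n \<longleftrightarrow>
     (\<exists>\<sigma>. strategy S \<sigma> \<and>
        (\<forall>xs. complete_play S n xs \<and> follows X Y \<sigma> xs \<longrightarrow>
           winner (W (last xs)) (mover Y (length xs - 1)) = X))"

fun has_outcome :: "nat set \<Rightarrow> (nat \<Rightarrow> outcome) \<Rightarrow> nat \<Rightarrow> outcome \<Rightarrow> bool" where
  "has_outcome S W n \<L> \<longleftrightarrow>
     has_winning_strategy S W Left Left n \<and> has_winning_strategy S W Left Right n"
| "has_outcome S W n \<R> \<longleftrightarrow>
     has_winning_strategy S W Right Left n \<and> has_winning_strategy S W Right Right n"
| "has_outcome S W n \<N> \<longleftrightarrow> (\<forall>X. has_winning_strategy S W X X n)"
| "has_outcome S W n \<P> \<longleftrightarrow> (\<forall>X. has_winning_strategy S W X (opponent X) n)"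

text \<open>This is well defined when \<open>0 \<notin> S\<close>; see \<open>has_outcome_ex1\<close> below. Only the values of \<open>W\<close> at
  terminal positions are relevant.\<close>

definition game_outcome :: "nat set \<Rightarrow> (nat \<Rightarrow> outcome) \<Rightarrow> nat \<Rightarrow> outcome" where
  "game_outcome S W n = (THE v. has_outcome S W n v)"

lemma opponent_opponent [simp]: "opponent (opponent X) = X"
  by (cases X) auto

lemma opponent_neq [simp]: "opponent X \<noteq> X" "X \<noteq> opponent X"
  by (cases X; simp)+

lemma neq_iff_opponent: "X \<noteq> Y \<longleftrightarrow> X = opponent Y"
  by (cases X; cases Y) auto

lemma mover_0 [simp]: "mover Y 0 = Y"
  by (simp add: mover_def)

lemma mover_Suc [simp]: "mover Y (Suc i) = mover (opponent Y) i"
  by (simp add: mover_def)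

lemma complete_play_terminal:
  assumes "terminal S n"
  shows "complete_play S n xs \<longleftrightarrow> xs = [n]"
proof (cases xs)
  case (Cons a ys)
  then show ?thesis
    using assms by (cases ys) (auto simp: complete_play_def terminal_def)
qed (simp add: complete_play_def)

lemma complete_play_nonterminal:
  assumes "\<not> terminal S n"
  shows "complete_play S n xs \<longleftrightarrow> (\<exists>s\<in>moves S n. \<exists>ys. xs = n # ys \<and> complete_play S (n - s) ys)"
proof (cases xs)
  case (Cons a ys)
  show ?thesis
  proof (cases ys)
    case Nil
    then show ?thesis
      using assms Cons by (auto simp: complete_play_def)
  next
    case ys: (Cons b zs)
    have "(\<forall>i. Suc i < length xs \<longrightarrow> Q (xs ! i) (xs ! Suc i)) \<longleftrightarrow>
        Q a b \<and> (\<forall>i. Suc i < length ys \<longrightarrow> Q (ys ! i) (ys ! Suc i))" for Q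
      unfolding Cons ys by (auto simp: nth_Cons split: nat.splits)
    from this[of "\<lambda>x y. \<exists>s\<in>moves S x. y = x - s"] show ?thesis
      unfolding complete_play_def using Cons ys by auto
  qed
qed (simp add: complete_play_def)

lemma follows_Cons:
  assumes "ys \<noteq> []"
  shows "follows X Y \<sigma> (n # ys) \<longleftrightarrow>
    (Y = X \<longrightarrow> hd ys = n - \<sigma> [n]) \<and> follows X (opponent Y) (\<lambda>h. \<sigma> (n # h)) ys"
proof -
  have all_split: "(\<forall>i. Q i) \<longleftrightarrow> Q 0 \<and> (\<forall>i. Q (Suc i))" for Q :: "nat \<Rightarrow> bool"
    by (metis not0_implies_Suc)
  show ?thesis
    unfolding follows_def by (subst all_split) (use assms in \<open>auto simp: hd_conv_nth\<close>)
qed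

lemma ex_strategy: "\<exists>\<sigma>. strategy S \<sigma>"
proof
  show "strategy S (\<lambda>h. SOME s. s \<in> moves S (last h))"
    by (auto simp: strategy_def terminal_def some_in_eq)
qed

lemma strategyD:
  "strategy S \<sigma> \<Longrightarrow> h \<noteq> [] \<Longrightarrow> \<not> terminal S (last h) \<Longrightarrow> \<sigma> h \<in> moves S (last h)"
  by (simp add: strategy_def)

lemma strategy_Cons:
  assumes "strategy S \<sigma>"
  shows "strategy S (\<lambda>h. \<sigma> (n # h))"
  unfolding strategy_def
proof (intro allI impI)
  fix h
  assume "h \<noteq> [] \<and> \<not> terminal S (last h)"
  then show "\<sigma> (n # h) \<in> moves S (last h)"
    using strategyD[OF assms, of "n # h"] by simp
qed

lemma has_winning_strategy_terminal:
  "terminal S n \<Longrightarrow> has_winning_strategy S W X Y n \<longleftrightarrow> winner (W n) Y = X"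
  using ex_strategy[of S]
  by (auto simp: has_winning_strategy_def complete_play_terminal follows_def)

lemma has_winning_strategy_own_move:
  assumes nt: "\<not> terminal S n"
  shows "has_winning_strategy S W X X n \<longleftrightarrow>
    (\<exists>s\<in>moves S n. has_winning_strategy S W X (opponent X) (n - s))"
proof
  assume "has_winning_strategy S W X X n"
  then obtain \<sigma> where st: "strategy S \<sigma>"
    and win: "\<And>xs. complete_play S n xs \<Longrightarrow> follows X X \<sigma> xs \<Longrightarrow>
      winner (W (last xs)) (mover X (length xs - 1)) = X"
    unfolding has_winning_strategy_def by blast
  define s where "s = \<sigma> [n]"
  have s: "s \<in> moves S n"
    using strategyD[OF st, of "[n]"] nt by (simp add: s_def)
  have "winner (W (last ys)) (mover (opponent X) (length ys - 1)) = X"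
    if ys: "complete_play S (n - s) ys" "follows X (opponent X) (\<lambda>h. \<sigma> (n # h)) ys" for ys
  proof -
    have "ys \<noteq> []" "hd ys = n - s"
      using ys by (auto simp: complete_play_def)
    moreover have "complete_play S n (n # ys)"
      unfolding complete_play_nonterminal[OF nt] using s ys(1) by blast
    moreover have "follows X X \<sigma> (n # ys)"
      using ys calculation by (simp add: follows_Cons s_def)
    ultimately show ?thesis
      using win[of "n # ys"] by (cases ys) auto
  qed
  with strategy_Cons[OF st] s show "\<exists>s\<in>moves S n. has_winning_strategy S W X (opponent X) (n - s)"
    unfolding has_winning_strategy_def by blast
next
  assume "\<exists>s\<in>moves S n. has_winning_strategy S W X (opponent X) (n - s)"
  then obtain s \<tau> where s: "s \<in> moves S n" and st: "strategy S \<tau>"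
    and win: "\<And>xs. complete_play S (n - s) xs \<Longrightarrow> follows X (opponent X) \<tau> xs \<Longrightarrow>
      winner (W (last xs)) (mover (opponent X) (length xs - 1)) = X"
    unfolding has_winning_strategy_def by blast
  define \<sigma> where "\<sigma> h = (if tl h \<noteq> [] then \<tau> (tl h) else if h = [n] then s else \<tau> h)" for h
  have "strategy S \<sigma>"
    unfolding strategy_def
  proof (intro allI impI)
    fix h
    assume "h \<noteq> [] \<and> \<not> terminal S (last h)"
    then show "\<sigma> h \<in> moves S (last h)"
      using strategyD[OF st, of "tl h"] strategyD[OF st, of h] s by (auto simp: \<sigma>_def last_tl)
  qed
  moreover have "winner (W (last xs)) (mover X (length xs - 1)) = X"
    if xs: "complete_play S n xs" "follows X X \<sigma> xs" for xs
  proof -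
    obtain t ys where ys: "xs = n # ys" "complete_play S (n - t) ys"
      using xs(1) complete_play_nonterminal[OF nt] by blast
    then have ne: "ys \<noteq> []"
      by (auto simp: complete_play_def)
    have *: "hd ys = n - s" "follows X (opponent X) (\<lambda>h. \<sigma> (n # h)) ys"
      using xs(2) ne unfolding ys(1) by (auto simp: follows_Cons \<sigma>_def)
    have "complete_play S (n - s) ys"
      using ys(2) *(1) unfolding complete_play_def by metis
    moreover have "follows X (opponent X) \<tau> ys"
      using *(2) ne unfolding follows_def \<sigma>_def by simp
    ultimately show ?thesis
      using win[of ys] ne unfolding ys(1) by (cases ys) auto
  qed
  ultimately show "has_winning_strategy S W X X n"
    unfolding has_winning_strategy_def by blast
qed

lemma has_winning_strategy_opponent_move:
  assumes nt: "\<not> terminal S n"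
  shows "has_winning_strategy S W X (opponent X) n \<longleftrightarrow>
    (\<forall>s\<in>moves S n. has_winning_strategy S W X X (n - s))"
proof
  assume "has_winning_strategy S W X (opponent X) n"
  then obtain \<sigma> where st: "strategy S \<sigma>"
    and win: "\<And>xs. complete_play S n xs \<Longrightarrow> follows X (opponent X) \<sigma> xs \<Longrightarrow>
      winner (W (last xs)) (mover (opponent X) (length xs - 1)) = X"
    unfolding has_winning_strategy_def by blast
  have "winner (W (last ys)) (mover X (length ys - 1)) = X"
    if s: "s \<in> moves S n"
      and ys: "complete_play S (n - s) ys" "follows X X (\<lambda>h. \<sigma> (n # h)) ys" for s ys
  proof -
    have "ys \<noteq> []"
      using ys by (auto simp: complete_play_def)
    moreover have "complete_play S n (n # ys)"
      unfolding complete_play_nonterminal[OF nt] using s ys(1) by blast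
    moreover have "follows X (opponent X) \<sigma> (n # ys)"
      using ys calculation by (simp add: follows_Cons)
    ultimately show ?thesis
      using win[of "n # ys"] by (cases ys) auto
  qed
  with strategy_Cons[OF st] show "\<forall>s\<in>moves S n. has_winning_strategy S W X X (n - s)"
    unfolding has_winning_strategy_def by blast
next
  assume all: "\<forall>s\<in>moves S n. has_winning_strategy S W X X (n - s)"
  define good where "good m \<tau> \<longleftrightarrow> strategy S \<tau> \<and>
    (has_winning_strategy S W X X m \<longrightarrow>
     (\<forall>xs. complete_play S m xs \<and> follows X X \<tau> xs \<longrightarrow>
        winner (W (last xs)) (mover X (length xs - 1)) = X))" for m \<tau>
  have "\<exists>\<tau>. good m \<tau>" for m
    using ex_strategy[of S] unfolding good_def has_winning_strategy_def by metis
  then obtain \<tau> where \<tau>: "\<And>m. good m (\<tau> m)"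
    by metis
  define \<sigma> where "\<sigma> h = (if tl h \<noteq> [] then \<tau> (hd (tl h)) (tl h) else \<tau> 0 h)" for h
  have "strategy S \<sigma>"
    unfolding strategy_def
  proof (intro allI impI)
    fix h
    assume "h \<noteq> [] \<and> \<not> terminal S (last h)"
    moreover have "strategy S (\<tau> m)" for m
      using \<tau>[of m] by (simp add: good_def)
    ultimately show "\<sigma> h \<in> moves S (last h)"
      using strategyD[of S "\<tau> (hd (tl h))" "tl h"] strategyD[of S "\<tau> 0" h]
      by (auto simp: \<sigma>_def last_tl)
  qed
  moreover have "winner (W (last xs)) (mover (opponent X) (length xs - 1)) = X"
    if xs: "complete_play S n xs" "follows X (opponent X) \<sigma> xs" for xs
  proof -
    obtain s ys where s: "s \<in> moves S n" and ys: "xs = n # ys" "complete_play S (n - s) ys"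
      using xs(1) complete_play_nonterminal[OF nt] by blast
    then have ne: "ys \<noteq> []" "hd ys = n - s"
      by (auto simp: complete_play_def)
    have "follows X X (\<lambda>h. \<sigma> (n # h)) ys"
      using xs(2) ne unfolding ys(1) by (auto simp: follows_Cons)
    then have "follows X X (\<tau> (n - s)) ys"
      using ne unfolding follows_def \<sigma>_def by (simp add: hd_take)
    then have "winner (W (last ys)) (mover X (length ys - 1)) = X"
      using \<tau>[of "n - s"] all s ys(2) unfolding good_def by blast
    then show ?thesis
      using ne unfolding ys(1) by (cases ys) auto
  qed
  ultimately show "has_winning_strategy S W X (opponent X) n"
    unfolding has_winning_strategy_def by blast
qed

lemma determined:
  assumes "0 \<notin> S"
  shows "has_winning_strategy S W X Y n \<longleftrightarrow> \<not> has_winning_strategy S W (opponent X) Y n"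
proof (induction n arbitrary: X Y rule: less_induct)
  case (less n)
  have own: "has_winning_strategy S W X X n \<longleftrightarrow> \<not> has_winning_strategy S W (opponent X) X n" for X
  proof (cases "terminal S n")
    case True
    then show ?thesis
      by (metis has_winning_strategy_terminal neq_iff_opponent)
  next
    case False
    have "n - s < n" if "s \<in> moves S n" for s
      using that assms by (cases "s = 0") (auto simp: moves_def)
    then have "has_winning_strategy S W X (opponent X) (n - s) \<longleftrightarrow>
        \<not> has_winning_strategy S W (opponent X) (opponent X) (n - s)" if "s \<in> moves S n" for s
      using less.IH that by blast
    then show ?thesis
      using has_winning_strategy_own_move[OF False, of W X]
        has_winning_strategy_opponent_move[OF False, of W "opponent X"] by auto
  qed
  show ?case
  proof (cases "X = Y")
    case True
    then show ?thesis using own[of X] by simp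
  next
    case False
    then have "Y = opponent X" by (simp add: neq_iff_opponent[symmetric])
    then show ?thesis using own[of "opponent X"] by simp
  qed
qed

lemma all_player: "(\<forall>X. Q X) \<longleftrightarrow> Q Left \<and> Q Right"
  by (metis player.exhaust)

lemma has_outcome_ex1:
  assumes "0 \<notin> S"
  shows "\<exists>!v. has_outcome S W n v"
proof -
  let ?H = "has_winning_strategy S W"
  have *: "?H Right Y n \<longleftrightarrow> \<not> ?H Left Y n" for Y
    using determined[OF assms, of W Right Y n] by simp
  have eq: "has_outcome S W n v \<longleftrightarrow>
      v = (if ?H Left Left n then if ?H Left Right n then \<L> else \<N>
           else if ?H Left Right n then \<P> else \<R>)" for v
    by (cases v) (auto simp: * all_player)
  show ?thesis
    unfolding eq by simp
qed

end

theory Submission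
  imports Defs
begin

text \<open>Whoever wins when moving second at \<open>n\<close> also wins when moving second at \<open>n + p\<close>: a removal
  of \<open>s\<close> is answered by the removal of \<open>p - s\<close>, which leads back to \<open>n\<close>. So along each residue class
  modulo \<open>p\<close> the truth value of ``\<open>X\<close> wins moving second'' changes at most once, and by determinacy
  these truth values for both players fix the outcome.\<close>

lemma has_winning_strategy_second_add_period:
  assumes sym: "p_symmetric p S"
    and win: "has_winning_strategy S W X (opponent X) n"
  shows "has_winning_strategy S W X (opponent X) (n + p)"
proof -
  obtain s\<^sub>0 where "s\<^sub>0 \<in> S" "s\<^sub>0 \<le> p"
    using sym by (auto simp: p_symmetric_def)
  \<comment> \<open>Needed even if \<open>n\<close> is terminal: the unfolding of strategies by one
    move requires a position with a legal move.\<close>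
  then have nt: "\<not> terminal S (n + p)"
    by (auto simp: terminal_def moves_def)
  have "has_winning_strategy S W X X (n + p - s)" if "s \<in> moves S (n + p)" for s
  proof -
    have "s \<le> p" "p - s \<in> S"
      using sym that by (auto simp: p_symmetric_def moves_def)
    then have reply: "p - s \<in> moves S (n + p - s)" and eq: "n + p - s - (p - s) = n"
      by (auto simp: moves_def)
    then have "\<not> terminal S (n + p - s)"
      by (auto simp: terminal_def)
    then show ?thesis
      unfolding has_winning_strategy_own_move[OF \<open>\<not> terminal S (n + p - s)\<close>]
      by (intro bexI[OF _ reply]) (simp only: eq win)
  qed
  then show ?thesis
    using has_winning_strategy_opponent_move[OF nt] by blast
qed

text \<open>Once true, \<open>Q\<close> stays true along its residue class modulo \<open>p\<close>.
  So the set \<open>B\<close> of switching points meets each class at most once and is finite; any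
  \<open>A\<close> above all of \<open>B\<close> works.\<close>

lemma eventually_periodic_if_add_closed:
  fixes Q :: "nat \<Rightarrow> bool"
  assumes p: "p \<ge> 1" and step: "\<And>n. Q n \<Longrightarrow> Q (n + p)"
  shows "\<exists>A. \<forall>m\<ge>A. Q (m + p) \<longleftrightarrow> Q m"
proof -
  define B where "B = {m. Q (m + p) \<and> \<not> Q m}"
  have iter: "Q (n + k * p)" if "Q n" for n k
  proof (induction k)
    case (Suc k)
    then show ?case using step[of "n + k * p"] by (simp add: algebra_simps)
  qed (use that in simp)
  have no_collision: "m mod p \<noteq> m' mod p" if "m \<in> B" "m' \<in> B" "m < m'" for m m'
  proof
    assume "m mod p = m' mod p"
    then have "p dvd m' - m"
      using that by (metis mod_eq_dvd_iff_nat less_imp_le)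
    then obtain k where k: "m' - m = p * k" ..
    \<comment> \<open>Splitting off one period lets \<open>iter\<close> start at
      \<open>m + p\<close>, where \<open>Q\<close> already holds, and reach \<open>m'\<close>, where
      it must fail.\<close>
    then obtain j where "k = Suc j"
      using \<open>m < m'\<close> by (cases k) auto
    then have "m' = m + p + j * p"
      using k that by (simp add: algebra_simps)
    then show False
      using iter[of "m + p" j] that by (simp add: B_def)
  qed
  then have "inj_on (\<lambda>m. m mod p) B"
    by (metis inj_onI linorder_neqE_nat)
  moreover have "finite ((\<lambda>m. m mod p) ` B)"
    by (rule finite_subset[of _ "{..<p}"]) (use p in auto)
  ultimately have "finite B"
    by (rule finite_imageD[rotated])
  then obtain A where "\<forall>m\<in>B. m < A"
    unfolding finite_nat_set_iff_bounded ..
  then show ?thesis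
    using step by (intro exI[of _ A]) (force simp: B_def)
qed

text \<open>By determinacy, a player wins moving first exactly if the opponent does not win moving
  second, so the second-mover data settle all four strategy questions.\<close>

lemma game_outcome_cong:
  assumes "0 \<notin> S"
    and second: "\<And>X. has_winning_strategy S W X (opponent X) m \<longleftrightarrow>
      has_winning_strategy S W X (opponent X) n"
  shows "game_outcome S W m = game_outcome S W n"
proof -
  have "has_winning_strategy S W X Y m \<longleftrightarrow> has_winning_strategy S W X Y n" for X Y
  proof (cases "X = Y")
    case True
    then show ?thesis
      using second[of "opponent X"] determined[OF assms(1), of W X X] by simp
  next
    case False
    then have "Y = opponent X"
      by (simp add: neq_iff_opponent)
    then show ?thesis
      using second by simp
  qed
  then have "has_outcome S W m v \<longleftrightarrow> has_outcome S W n v" for v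
    by (cases v) auto
  then show ?thesis
    by (simp add: game_outcome_def)
qed

theorem theorem11:
  fixes p :: nat and S :: "nat set" and W :: "nat \<Rightarrow> outcome"
  assumes "p \<ge> 1"
    and "p_symmetric p S"
  shows "\<exists>A::nat. \<forall>m\<ge>A. game_outcome S W (m + p) = game_outcome S W m"
proof -
  have "\<exists>A. \<forall>m\<ge>A. has_winning_strategy S W X (opponent X) (m + p) \<longleftrightarrow>
      has_winning_strategy S W X (opponent X) m" for X
    using assms(1)
    by (rule eventually_periodic_if_add_closed)
      (rule has_winning_strategy_second_add_period[OF assms(2)])
  then obtain A where A: "\<And>X m. m \<ge> A X \<Longrightarrow> has_winning_strategy S W X (opponent X) (m + p) \<longleftrightarrow>
      has_winning_strategy S W X (opponent X) m"
    by metis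
  have "0 \<notin> S"
    using assms(2) by (auto simp: p_symmetric_def)
  \<comment> \<open>The threshold depends on the player; the maximum serves both.\<close>
  moreover have "A X \<le> max (A Left) (A Right)" for X
    by (cases X) auto
  ultimately have "game_outcome S W (m + p) = game_outcome S W m"
    if "m \<ge> max (A Left) (A Right)" for m
    by (intro game_outcome_cong A) (use that order_trans in blast)+
  then show ?thesis
    by blast
qed

end
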